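(* There is an absolute constant $c>0$ such that for all positive integers $k$ and $N$ and every 3D $k\times N$ rectangle $R$, the directed tile complexity of $R$ at temperature 1 satisfies $K^1_{USA}(R)\ge c\,N^{1/k}$; that is, $K^1_{USA}(R^3_{k,N})=\Omega\left(N^{1/k}\right)$, where the implied constant depends neither on $k$ nor on $N$.
   Context: We work in the 3D abstract Tile Assembly Model (aTAM). A tile type is a unit cube each of whose six sides carries a glue, a pair (label, nonnegative integer strength); a tile set $T$ is a finite set of tile types, each available in unlimited copies. A tile assembly system (TAS) is $\mathcal{T}=(T,\sigma,\tau)$ where $\sigma$ is a seed assembly consisting of a single tile placed at a fixed location of $\mathbb{Z}^3$ and $\tau\in\mathbb{Z}^+$ is the temperature. Two tiles at adjacent locations bind if the glues on their abutting sides are equal (in label and strength) and have positive strength. An assembly is a connected placement of tiles on $\mathbb{Z}^3$; starting from the seed, a tile may be added at an empty location if the sum of strengths of glues with which it binds to the current assembly is at least $\tau$ (at temperature 1: it binds to at least one adjacent tile). Assemblies obtainable this way are producible; a producible assembly is terminal if no tile can be added; $\mathcal{T}$ is directed if it has exactly one terminal producible assembly. A shape $X\subseteq\mathbb{Z}^3$ uniquely self-assembles in $\mathcal{T}$ if $\mathcal{T}$ is directed and its unique terminal assembly has domain exactly $X$. The directed tile complexity $K^\tau_{USA}(X)$ is the minimum of $|T|$ over all TAS $(T,\sigma,\tau)$ in which $X$ uniquely self-assembles. For $k,N\in\mathbb{Z}^+$, a 3D $k\times N$ rectangle $R^3_{k,N}$ is any set $R$ with $\{0,\dots,N-1\}\times\{0,\dots,k-1\}\times\{0\}\subseteq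 R\subseteq \{0,\dots,N-1\}\times\{0,\dots,k-1\}\times\{0,1\}$. *)

theory Defs
  imports "HOL-Library.Extended_Real"
begin

section \<open>The three-dimensional abstract Tile Assembly Model\<close>

type_synonym pos = "int \<times> int \<times> int"

datatype dir = East | West | North | South | Up | Down

fun opposite :: "dir \<Rightarrow> dir" where
  "opposite East = West"
| "opposite West = East"
| "opposite North = South"
| "opposite South = North"
| "opposite Up = Down"
| "opposite Down = Up"

fun neighbor :: "pos \<Rightarrow> dir \<Rightarrow> pos" where
  "neighbor (x, y, z) East = (x + 1, y, z)"
| "neighbor (x, y, z) West = (x - 1, y, z)"
| "neighbor (x, y, z) North = (x, y + 1, z)"
| "neighbor (x, y, z) South = (x, y - 1, z)"
| "neighbor (x, y, z) Up = (x, y, z + 1)"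
| "neighbor (x, y, z) Down = (x, y, z - 1)"

lemma UNIV_dir: "(UNIV :: dir set) = {East, West, North, South, Up, Down}"
  using dir.exhaust by blast

instance dir :: finite
  by standard (simp add: UNIV_dir)

text \<open>A glue is a pair of a label and a strength. A tile type assigns a glue to each of the
  six sides; tiles are not rotated.\<close>

type_synonym glue = "string \<times> nat"
type_synonym tile = "dir \<Rightarrow> glue"
type_synonym assembly = "pos \<rightharpoonup> tile"

definition tas :: "tile set \<Rightarrow> assembly \<Rightarrow> nat \<Rightarrow> bool" where
  "tas T \<sigma> \<tau> \<longleftrightarrow> finite T \<and> (\<exists>p. \<exists>t\<in>T. \<sigma> = [p \<mapsto> t]) \<and> \<tau> > 0"

text \<open>The strength with which tile \<open>t\<close> is bound to tile \<open>s\<close> lying next to it in direction \<open>d\<close>.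
  Equal glues of strength \<open>0\<close> contribute nothing, so positivity needs no separate test.\<close>

definition bond_strength :: "tile \<Rightarrow> dir \<Rightarrow> tile \<Rightarrow> nat" where
  "bond_strength t d s = (if t d = s (opposite d) then snd (t d) else 0)"

definition attach_strength :: "assembly \<Rightarrow> pos \<Rightarrow> tile \<Rightarrow> nat" where
  "attach_strength \<alpha> p t =
     (\<Sum>d\<in>UNIV. case \<alpha> (neighbor p d) of None \<Rightarrow> 0 | Some s \<Rightarrow> bond_strength t d s)"

definition attachable :: "tile set \<Rightarrow> nat \<Rightarrow> assembly \<Rightarrow> pos \<Rightarrow> tile \<Rightarrow> bool" where
  "attachable T \<tau> \<alpha> p t \<longleftrightarrow> t \<in> T \<and> \<alpha> p = None \<and> \<tau> \<le> attach_strength \<alpha> p t"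

definition assembly_step :: "tile set \<Rightarrow> nat \<Rightarrow> assembly \<Rightarrow> assembly \<Rightarrow> bool" where
  "assembly_step T \<tau> \<alpha> \<beta> \<longleftrightarrow> (\<exists>p t. attachable T \<tau> \<alpha> p t \<and> \<beta> = \<alpha>(p \<mapsto> t))"

text \<open>Assembly sequences have \<open>n\<close> steps, where \<open>n = \<infinity>\<close> is allowed. Only the entries \<open>A i\<close> with
  \<open>i \<le> n\<close> matter. The result is the last assembly if \<open>n\<close> is finite, and the limit (union) of all
  assemblies in the sequence if \<open>n = \<infinity>\<close>.\<close>

definition assembly_sequence ::
  "tile set \<Rightarrow> assembly \<Rightarrow> nat \<Rightarrow> enat \<Rightarrow> (nat \<Rightarrow> assembly) \<Rightarrow> bool" where
  "assembly_sequence T \<sigma> \<tau> n A \<longleftrightarrow>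
     A 0 = \<sigma> \<and> (\<forall>i. enat i < n \<longrightarrow> assembly_step T \<tau> (A i) (A (Suc i)))"

definition sequence_result :: "enat \<Rightarrow> (nat \<Rightarrow> assembly) \<Rightarrow> assembly \<Rightarrow> bool" where
  "sequence_result n A \<alpha> \<longleftrightarrow>
     (\<forall>p t. \<alpha> p = Some t \<longleftrightarrow> (\<exists>i. enat i \<le> n \<and> A i p = Some t))"

definition producible :: "tile set \<Rightarrow> assembly \<Rightarrow> nat \<Rightarrow> assembly \<Rightarrow> bool" where
  "producible T \<sigma> \<tau> \<alpha> \<longleftrightarrow>
     (\<exists>n A. assembly_sequence T \<sigma> \<tau> n A \<and> sequence_result n A \<alpha>)"

definition terminal :: "tile set \<Rightarrow> assembly \<Rightarrow> nat \<Rightarrow> assembly \<Rightarrow> bool" where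
  "terminal T \<sigma> \<tau> \<alpha> \<longleftrightarrow> producible T \<sigma> \<tau> \<alpha> \<and> (\<nexists>p t. attachable T \<tau> \<alpha> p t)"

definition directed :: "tile set \<Rightarrow> assembly \<Rightarrow> nat \<Rightarrow> bool" where
  "directed T \<sigma> \<tau> \<longleftrightarrow> (\<exists>!\<alpha>. terminal T \<sigma> \<tau> \<alpha>)"

definition uniquely_self_assembles ::
  "pos set \<Rightarrow> tile set \<Rightarrow> assembly \<Rightarrow> nat \<Rightarrow> bool" where
  "uniquely_self_assembles X T \<sigma> \<tau> \<longleftrightarrow>
     directed T \<sigma> \<tau> \<and> (\<exists>\<alpha>. terminal T \<sigma> \<tau> \<alpha> \<and> dom \<alpha> = X)"

text \<open>The value is \<open>\<infinity>\<close> for shapes that no system uniquely self-assembles; otherwise the infimum,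
  being taken in \<open>enat\<close>, is a minimum.\<close>

definition K_USA :: "nat \<Rightarrow> pos set \<Rightarrow> enat" where
  "K_USA \<tau> X =
     Inf {enat (card T) | T. \<exists>\<sigma>. tas T \<sigma> \<tau> \<and> uniquely_self_assembles X T \<sigma> \<tau>}"

definition rectangle3 :: "nat \<Rightarrow> nat \<Rightarrow> pos set \<Rightarrow> bool" where
  "rectangle3 k N R \<longleftrightarrow>
     {0..<int N} \<times> {0..<int k} \<times> {0} \<subseteq> R \<and> R \<subseteq> {0..<int N} \<times> {0..<int k} \<times> {0, 1}"

end

theory Submission
  imports Defs "HOL-Library.FuncSet"
begin

text \<open>Follow a simple path of bonded tiles from the seed to the farther end of the rectangle. At a cut
  between two columns, record which of the at most \<open>2 k\<close> places the path crosses outward and inward,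
  and the tile just behind each outward crossing. There are at most \<open>k\<close> outward crossings, hence at
  most \<open>(16 * card T) ^ k\<close> such records. If two cuts had the same record, the pieces of the path
  inside the farther cut and the translated pieces outside the nearer cut could be spliced to
  a producible assembly that leaves the rectangle. So the number of cuts, and with it the length of the
  rectangle, is at most of the order of the number of records.\<close>

section \<open>Extending producible assemblies to terminal ones\<close>

lemma assembly_step_mono: "assembly_step T \<tau> \<alpha> \<beta> \<Longrightarrow> \<alpha> \<subseteq>\<^sub>m \<beta>"
  by (auto simp: assembly_step_def attachable_def map_le_def)

lemma sequence_mono:
  assumes "\<And>i. enat i < n \<Longrightarrow> assembly_step T \<tau> (A i) (A (Suc i))" "i \<le> j" "enat j \<le> n"
  shows "A i \<subseteq>\<^sub>m A j"
  using assms(2,3)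
proof (induction j rule: dec_induct)
  case (step j)
  from step.prems have "enat j < n"
    using Suc_ile_eq by blast
  with step.IH assms(1)[of j] show ?case
    by (meson assembly_step_mono map_le_trans order_less_imp_le)
qed simp

lemma finite_sequence_producible:
  assumes "(assembly_step T \<tau>)\<^sup>*\<^sup>* \<sigma> \<beta>"
  shows "producible T \<sigma> \<tau> \<beta>"
proof -
  obtain m where "(assembly_step T \<tau> ^^ m) \<sigma> \<beta>"
    using assms rtranclp_imp_relpowp by metis
  then obtain B where B: "B 0 = \<sigma>" "B m = \<beta>" "\<And>i. i < m \<Longrightarrow> assembly_step T \<tau> (B i) (B (Suc i))"
    by (auto simp: relpowp_fun_conv)
  have "B i \<subseteq>\<^sub>m \<beta>" if "i \<le> m" for i
    using sequence_mono[of "enat m" T \<tau> B i m] B that by auto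
  then have "sequence_result (enat m) B \<beta>"
    unfolding sequence_result_def using B(2) by (auto simp: map_le_def dom_def)
  with B show ?thesis
    unfolding producible_def assembly_sequence_def by (metis enat_ord_simps(2))
qed

text \<open>Grow fairly: always fill an attachable position of least code. If this never stops, the
  union is still terminal: a position left attachable would be attachable at all late stages, each
  of which fills a new position of no larger code, and there are only finitely many of
  these.\<close>

lemma producible_extends_to_terminal:
  assumes "(assembly_step T \<tau>)\<^sup>*\<^sup>* \<sigma> \<beta>"
  shows "\<exists>\<gamma>. terminal T \<sigma> \<tau> \<gamma> \<and> \<beta> \<subseteq>\<^sub>m \<gamma>"
proof -
  define fair where "fair \<gamma> \<gamma>' \<longleftrightarrow> (\<exists>p t. attachable T \<tau> \<gamma> p t \<and> \<gamma>' = \<gamma>(p \<mapsto> t) \<and>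
    (\<forall>q s. attachable T \<tau> \<gamma> q s \<longrightarrow> to_nat p \<le> to_nat q))" for \<gamma> \<gamma>'
  have fair_ex: "\<exists>\<gamma>'. fair \<gamma> \<gamma>'" if "attachable T \<tau> \<gamma> p t" for \<gamma> p t
  proof -
    obtain q where "\<exists>t. attachable T \<tau> \<gamma> q t"
      and "\<forall>r. (\<exists>t. attachable T \<tau> \<gamma> r t) \<longrightarrow> to_nat q \<le> to_nat r"
      using ex_has_least_nat[of "\<lambda>q. \<exists>t. attachable T \<tau> \<gamma> q t" p to_nat] \<open>attachable T \<tau> \<gamma> p t\<close>
      by blast
    then show ?thesis unfolding fair_def by blast
  qed
  have fair_step: "assembly_step T \<tau> \<gamma> \<gamma>'" if "fair \<gamma> \<gamma>'" for \<gamma> \<gamma>'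
    using that by (auto simp: fair_def assembly_step_def)
  define nxt where "nxt \<gamma> = (if \<exists>\<gamma>'. fair \<gamma> \<gamma>' then SOME \<gamma>'. fair \<gamma> \<gamma>' else \<gamma>)" for \<gamma>
  have nxt: "fair \<gamma> (nxt \<gamma>)" if "\<exists>\<gamma>'. fair \<gamma> \<gamma>'" for \<gamma>
    using that by (simp add: nxt_def someI_ex)
  define G where "G i = (nxt ^^ i) \<beta>" for i
  have G_reach: "(assembly_step T \<tau>)\<^sup>*\<^sup>* \<beta> (G i)" for i
  proof (induction i)
    case (Suc i)
    have "G (Suc i) = nxt (G i)" by (simp add: G_def)
    moreover have "(assembly_step T \<tau>)\<^sup>*\<^sup>* (G i) (nxt (G i))"
      using nxt[of "G i"] fair_step by (cases "\<exists>\<gamma>'. fair (G i) \<gamma>'") (auto simp: nxt_def)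
    ultimately show ?case using Suc by simp
  qed (simp add: G_def)
  show ?thesis
  proof (cases "\<exists>i. \<nexists>p t. attachable T \<tau> (G i) p t")
    case True
    then obtain i where i: "\<nexists>p t. attachable T \<tau> (G i) p t" by blast
    have "\<gamma> \<subseteq>\<^sub>m \<gamma>'" if "(assembly_step T \<tau>)\<^sup>*\<^sup>* \<gamma> \<gamma>'" for \<gamma> \<gamma>'
      using that by induction (auto intro: map_le_trans assembly_step_mono)
    with i G_reach[of i] assms show ?thesis
      unfolding terminal_def by (metis finite_sequence_producible rtranclp_trans)
  next
    case False
    then have fairG: "fair (G i) (G (Suc i))" for i
    proof -
      have "\<exists>\<gamma>'. fair (G i) \<gamma>'" using False fair_ex by blast
      from nxt[OF this] show ?thesis by (simp add: G_def)
    qed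
    obtain m where "(assembly_step T \<tau> ^^ m) \<sigma> \<beta>"
      using assms rtranclp_imp_relpowp by metis
    then obtain B where B: "B 0 = \<sigma>" "B m = \<beta>"
      "\<And>i. i < m \<Longrightarrow> assembly_step T \<tau> (B i) (B (Suc i))"
      by (auto simp: relpowp_fun_conv)
    define A where "A i = (if i < m then B i else G (i - m))" for i
    have G0: "G 0 = \<beta>" by (simp add: G_def)
    have A0: "A 0 = \<sigma>" using B(1,2) G0 by (auto simp: A_def)
    have A_ge: "fair (A i) (A (Suc i))" if "i \<ge> m" for i
      using fairG[of "i - m"] that by (simp add: A_def Suc_diff_le)
    have A_step: "assembly_step T \<tau> (A i) (A (Suc i))" for i
    proof (cases "i < m")
      case True
      then have "A (Suc i) = B (Suc i)"
        using B(2) G0 by (cases "Suc i = m") (auto simp: A_def)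
      with True B(3) show ?thesis by (simp add: A_def)
    qed (use A_ge fair_step in force)
    have A_mono: "A i \<subseteq>\<^sub>m A j" if "i \<le> j" for i j
      using sequence_mono[of \<infinity> T \<tau> A i j] A_step that by simp
    have A_agree: "A i p = A j p" if "A i p \<noteq> None" "A j p \<noteq> None" for i j p
      using A_mono[of i j] A_mono[of j i] that unfolding map_le_def
      by (metis domIff nle_le)
    \<comment> \<open>The union of the chain. Which index \<open>SOME\<close> picks is immaterial,
      because the assemblies agree wherever they are defined.\<close>
    define \<gamma> where "\<gamma> p = (if \<exists>i. A i p \<noteq> None then A (SOME i. A i p \<noteq> None) p else None)" for p
    have \<gamma>_eq: "\<gamma> p = A i p" if "A i p \<noteq> None" for i p
    proof -
      from that have "A (SOME i. A i p \<noteq> None) p \<noteq> None"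
        by (rule someI[of "\<lambda>i. A i p \<noteq> None"])
      with that show ?thesis unfolding \<gamma>_def using A_agree by auto
    qed
    have \<gamma>_None: "\<gamma> p = None \<longleftrightarrow> (\<forall>i. A i p = None)" for p
    proof (cases "\<exists>i. A i p \<noteq> None")
      case True
      then show ?thesis using \<gamma>_eq[of _ p] by metis
    next
      case False
      then show ?thesis unfolding \<gamma>_def by auto
    qed
    have res: "sequence_result \<infinity> A \<gamma>"
      unfolding sequence_result_def by (metis \<gamma>_None \<gamma>_eq enat_ord_code(3) option.distinct(1))
    have stuck: "\<not> attachable T \<tau> \<gamma> p t" for p t
    proof
      assume att: "attachable T \<tau> \<gamma> p t"
      have "\<forall>\<^sub>F j in sequentially. A j q = \<gamma> q" for q
      proof (cases "\<gamma> q = None")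
        case True
        with \<gamma>_None have "A j q = None" for j by blast
        with True show ?thesis by simp
      next
        case False
        then obtain i where i: "A i q \<noteq> None" using \<gamma>_None by metis
        have "A j q = \<gamma> q" if "j \<ge> i" for j
          using A_mono[OF that] i \<gamma>_eq[OF i] unfolding map_le_def by (metis domIff)
        then show ?thesis unfolding eventually_sequentially by blast
      qed
      then have "\<forall>\<^sub>F j in sequentially. \<forall>d. A j (neighbor p d) = \<gamma> (neighbor p d)"
        by (simp add: eventually_all_finite)
      then obtain i0 where i0: "\<And>j d. j \<ge> i0 \<Longrightarrow> A j (neighbor p d) = \<gamma> (neighbor p d)"
        unfolding eventually_sequentially by blast
      \<comment> \<open>Attachability depends only on \<open>p\<close> being empty and on its six
        neighbours, which have reached their final state by stage \<open>i0\<close>.\<close>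
      have attj: "attachable T \<tau> (A j) p t" if "j \<ge> i0" for j
        using att i0[OF that] \<gamma>_None[of p] by (simp add: attachable_def attach_strength_def)
      define J where "J = {max i0 m..}"
      have "\<exists>q. to_nat q \<le> to_nat p \<and> A j q = None \<and> A (Suc j) q \<noteq> None" if "j \<in> J" for j
      proof -
        from that A_ge[of j] have "fair (A j) (A (Suc j))" by (simp add: J_def)
        moreover have jp: "attachable T \<tau> (A j) p t" using attj[of j] that by (simp add: J_def)
        ultimately obtain q s where "attachable T \<tau> (A j) q s" "A (Suc j) = (A j)(q \<mapsto> s)"
          "to_nat q \<le> to_nat p"
          using jp unfolding fair_def by blast
        then show ?thesis by (intro exI[of _ q]) (simp add: attachable_def)
      qed
      then obtain Q where Q: "\<And>j. j \<in> J \<Longrightarrow> to_nat (Q j) \<le> to_nat p"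
        "\<And>j. j \<in> J \<Longrightarrow> A j (Q j) = None" "\<And>j. j \<in> J \<Longrightarrow> A (Suc j) (Q j) \<noteq> None"
        by metis
      have "inj_on Q J"
      proof (rule linorder_inj_onI)
        fix i j assume ij: "i < j" "i \<in> J" "j \<in> J"
        then have "A j (Q i) \<noteq> None"
          using A_mono[of "Suc i" j] Q(3)[of i] unfolding map_le_def by (metis Suc_leI domIff)
        with Q(2)[of j] ij show "Q i \<noteq> Q j" by metis
      qed auto
      moreover have "finite (Q ` J)"
      proof (rule finite_subset)
        show "Q ` J \<subseteq> to_nat -` {..to_nat p}" using Q(1) by auto
        show "finite (to_nat -` {..to_nat p} :: pos set)" by (rule finite_vimageI) auto
      qed
      ultimately have "finite J" using finite_imageD by blast
      then show False by (simp add: J_def infinite_Ici)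
    qed
    have "producible T \<sigma> \<tau> \<gamma>"
      unfolding producible_def assembly_sequence_def using A0 A_step res by blast
    moreover have "\<beta> \<subseteq>\<^sub>m \<gamma>"
      using G0 \<gamma>_eq[of m] by (auto simp: map_le_def A_def)
    ultimately show ?thesis using stuck by (auto simp: terminal_def)
  qed
qed

section \<open>Directed systems at temperature one\<close>

lemma opposite_opposite [simp]: "opposite (opposite d) = d"
  by (cases d) auto

lemma neighbor_opposite [simp]: "neighbor (neighbor p d) (opposite d) = p"
  by (cases p; cases d) auto

definition bonded :: "assembly \<Rightarrow> pos \<Rightarrow> pos \<Rightarrow> bool" where
  "bonded \<alpha> p q \<longleftrightarrow> (\<exists>d t s. q = neighbor p d \<and> \<alpha> p = Some t \<and> \<alpha> q = Some s \<and>
     t d = s (opposite d) \<and> snd (t d) > 0)"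

text \<open>This is where temperature one matters: a sum of naturals is at least 1 iff some summand
  is nonzero, so a single bond suffices.\<close>

lemma attach_strength_pos_iff:
  "1 \<le> attach_strength \<alpha> p t \<longleftrightarrow>
     (\<exists>d s. \<alpha> (neighbor p d) = Some s \<and> t d = s (opposite d) \<and> snd (t d) > 0)"
proof -
  have "1 \<le> attach_strength \<alpha> p t \<longleftrightarrow> attach_strength \<alpha> p t \<noteq> 0" by auto
  then show ?thesis
    by (auto simp: attach_strength_def bond_strength_def split: option.splits)
qed

section \<open>Translations along the first axis\<close>

definition shift :: "int \<Rightarrow> pos \<Rightarrow> pos" where
  "shift w p = (fst p + w, snd p)"

lemma shift_simps [simp]: "fst (shift w p) = fst p + w" "snd (shift w p) = snd p"
  by (simp_all add: shift_def)

lemma shift_inj [simp]: "shift w p = shift w q \<longleftrightarrow> p = q"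
  by (auto simp: shift_def prod_eq_iff)

lemma neighbor_shift: "neighbor (shift w p) d = shift w (neighbor p d)"
  by (cases p; cases d) (auto simp: shift_def)

lemma neighbor_coordinates:
  "\<bar>fst (neighbor p d) - fst p\<bar> \<le> 1"
  "fst (neighbor p d) \<noteq> fst p \<Longrightarrow> snd (neighbor p d) = snd p"
  by (cases p; cases d; auto)+

locale directed_system =
  fixes T :: "tile set" and seed :: pos and t0 :: tile and \<alpha> :: assembly
  assumes finite_T: "finite T" and t0: "t0 \<in> T"
    and directed: "directed T [seed \<mapsto> t0] 1"
    and terminal: "terminal T [seed \<mapsto> t0] 1 \<alpha>"
begin

abbreviation grows :: "assembly \<Rightarrow> bool" where
  "grows \<equiv> (assembly_step T 1)\<^sup>*\<^sup>* [seed \<mapsto> t0]"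

text \<open>Whatever is grown extends to a terminal assembly, and directedness leaves only
  \<open>\<alpha>\<close>.\<close>

lemma grows_le: "grows \<beta> \<Longrightarrow> \<beta> \<subseteq>\<^sub>m \<alpha>"
  using producible_extends_to_terminal[of T 1 _ \<beta>] directed terminal
  unfolding directed_def by metis

lemma seed_tile: "\<alpha> seed = Some t0"
  using grows_le[of "[seed \<mapsto> t0]"] by (auto simp: map_le_def)

text \<open>Since \<open>s\<close> can attach, the enlarged assembly is producible and hence part of
  \<open>\<alpha>\<close>. It is not assumed that \<open>\<alpha>\<close> has any tile at the new
  position; this is what carries growth to unexpected places in the splice.\<close>

lemma growth_forced:
  assumes "grows (\<alpha> |` P)" "p \<in> P" "\<alpha> p = Some t" "neighbor p d \<notin> P"
    and "s \<in> T" "t d = s (opposite d)" "snd (t d) > 0"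
  shows "\<alpha> (neighbor p d) = Some s" "grows (\<alpha> |` insert (neighbor p d) P)"
proof -
  let ?q = "neighbor p d"
  have "1 \<le> attach_strength (\<alpha> |` P) ?q s"
    unfolding attach_strength_pos_iff
    by (rule exI[of _ "opposite d"]) (use assms in \<open>auto simp: restrict_map_def\<close>)
  then have "attachable T 1 (\<alpha> |` P) ?q s"
    using assms by (simp add: attachable_def)
  then have "assembly_step T 1 (\<alpha> |` P) ((\<alpha> |` P)(?q \<mapsto> s))"
    unfolding assembly_step_def by blast
  with assms(1) have *: "grows ((\<alpha> |` P)(?q \<mapsto> s))"
    by (meson rtranclp.rtrancl_into_rtrancl)
  from grows_le[OF this] show "\<alpha> ?q = Some s"
    by (auto simp: map_le_def)
  then have "(\<alpha> |` P)(?q \<mapsto> s) = \<alpha> |` insert ?q P"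
    by (auto simp: restrict_map_def fun_eq_iff)
  with * show "grows (\<alpha> |` insert ?q P)" by simp
qed

section \<open>Simple bonded paths from the seed\<close>

definition simple_path :: "nat \<Rightarrow> (nat \<Rightarrow> pos) \<Rightarrow> bool" where
  "simple_path n p \<longleftrightarrow> p 0 = seed \<and> inj_on p {..n} \<and> (\<forall>i<n. bonded \<alpha> (p i) (p (Suc i)))"

text \<open>Every tile of \<open>\<alpha>\<close> appears at a finite stage. A new tile bonds to an
  older one, whose path is extended by one step; that path uses only positions filled before, so the
  extension stays simple.\<close>

lemma terminal_structure:
  assumes "\<alpha> q = Some s"
  shows "s \<in> T" "\<exists>n p. simple_path n p \<and> p n = q"
proof -
  obtain m A where A: "A 0 = [seed \<mapsto> t0]" "\<And>i. enat i < m \<Longrightarrow> assembly_step T 1 (A i) (A (Suc i))"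
    and res: "sequence_result m A \<alpha>"
    using terminal unfolding terminal_def producible_def assembly_sequence_def by blast
  have A_\<alpha>: "\<alpha> r = Some u" if "enat i \<le> m" "A i r = Some u" for i r u
    using res that unfolding sequence_result_def by blast
  have *: "\<forall>r u. A i r = Some u \<longrightarrow> u \<in> T \<and>
      (\<exists>n p. simple_path n p \<and> p n = r \<and> p ` {..n} \<subseteq> dom (A i))" if "enat i \<le> m" for i
    using that
  proof (induction i)
    case 0
    have "simple_path 0 (\<lambda>_. seed)" by (simp add: simple_path_def)
    then show ?case using A(1) t0 by (auto split: if_splits intro!: exI[of _ 0] exI[of _ "\<lambda>_. seed"])
  next
    case (Suc i)
    then have i: "enat i < m" using Suc_ile_eq by blast
    then obtain x t where xt: "attachable T 1 (A i) x t" "A (Suc i) = (A i)(x \<mapsto> t)"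
      using A(2)[of i] unfolding assembly_step_def by blast
    have IH: "u \<in> T" "\<exists>n p. simple_path n p \<and> p n = r \<and> p ` {..n} \<subseteq> dom (A i)"
      if "A i r = Some u" for r u
      using Suc.IH order_less_imp_le[OF i] that by blast+
    obtain d s where ds: "A i (neighbor x d) = Some s" "t d = s (opposite d)" "snd (t d) > 0"
      using xt(1) unfolding attachable_def attach_strength_pos_iff by blast
    from IH(2)[OF ds(1)] obtain n p where p: "simple_path n p" "p n = neighbor x d"
      "p ` {..n} \<subseteq> dom (A i)" by blast
    have xnone: "A i x = None" using xt(1) by (simp add: attachable_def)
    have "bonded \<alpha> (neighbor x d) x"
      unfolding bonded_def
    proof (intro exI conjI)
      show "\<alpha> (neighbor x d) = Some s" using A_\<alpha>[of i] i ds(1) by simp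
      show "\<alpha> x = Some t" using A_\<alpha>[of "Suc i"] Suc.prems xt(2) by simp
    qed (use ds in auto)
    moreover have "\<forall>j\<le>n. p j \<noteq> x" "\<forall>j\<le>n. x \<noteq> p j"
      using p(3) xnone by auto
    ultimately have "simple_path (Suc n) (p(Suc n := x))"
      using p(1,2) by (auto simp: simple_path_def inj_on_def less_Suc_eq le_Suc_eq)
    moreover have "(p(Suc n := x)) ` {..Suc n} \<subseteq> dom (A (Suc i))"
    proof -
      have "(p(Suc n := x)) ` {..Suc n} \<subseteq> insert x (p ` {..n})" by (auto simp: le_Suc_eq)
      also have "\<dots> \<subseteq> insert x (dom (A i))" using p(3) by (rule insert_mono)
      finally show ?thesis using xt(2) by simp
    qed
    ultimately have new: "\<exists>n p. simple_path n p \<and> p n = x \<and> p ` {..n} \<subseteq> dom (A (Suc i))"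
      by (intro exI[of _ "Suc n"] exI[of _ "p(Suc n := x)"]) auto
    have old: "\<exists>n p. simple_path n p \<and> p n = r \<and> p ` {..n} \<subseteq> dom (A (Suc i))"
      if "A i r = Some u" for r u
    proof -
      have "dom (A i) \<subseteq> dom (A (Suc i))" using xt(2) by auto
      then show ?thesis using IH(2)[OF that] order_trans by blast
    qed
    show ?case
    proof (intro allI impI)
      fix r u assume "A (Suc i) r = Some u"
      then show "u \<in> T \<and> (\<exists>n p. simple_path n p \<and> p n = r \<and> p ` {..n} \<subseteq> dom (A (Suc i)))"
        using new old[of r u] IH(1)[of r u] xt by (cases "r = x") (auto simp: attachable_def)
    qed
  qed
  obtain i where i: "enat i \<le> m" "A i q = Some s"
    using res assms unfolding sequence_result_def by blast
  note q = *[OF i(1), rule_format, OF i(2)]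
  then show "s \<in> T" by (rule conjunct1)
  from q show "\<exists>n p. simple_path n p \<and> p n = q" by blast
qed

end

section \<open>Crossing patterns and splicing\<close>

text \<open>Injectivity pulls a repetition in the orbit back to the start \<open>s\<close>, which is
  not a value of \<open>f\<close>. So an orbit avoiding \<open>e\<close> would be infinite inside
  the finite set \<open>S\<close>.\<close>

lemma injective_orbit:
  fixes f :: "'a \<Rightarrow> 'a"
  assumes "finite S" "s \<in> S" "f ` (S - {e}) \<subseteq> S" "inj_on f (S - {e})" "s \<notin> f ` (S - {e})"
  obtains n where "(f ^^ n) s = e" "inj_on (\<lambda>i. (f ^^ i) s) {..n}"
    "\<And>i. i \<le> n \<Longrightarrow> (f ^^ i) s \<in> S" "\<And>i. i < n \<Longrightarrow> (f ^^ i) s \<noteq> e"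
proof -
  let ?g = "\<lambda>i. (f ^^ i) s"
  have inS: "?g i \<in> S" if "\<And>j. j < i \<Longrightarrow> ?g j \<noteq> e" for i
    using that
  proof (induction i)
    case (Suc i)
    then have "?g i \<in> S - {e}" by auto
    with assms(3) show ?case by auto
  qed (use assms(2) in simp)
  have neq: "?g i \<noteq> ?g j" if "i < j" "\<And>k. k < j \<Longrightarrow> ?g k \<noteq> e" for i j
    using that
  proof (induction i arbitrary: j)
    case 0
    then obtain j' where j': "j = Suc j'" by (cases j) auto
    then have "?g j' \<in> S - {e}" using 0 inS[of j'] by auto
    with assms(5) j' show ?case by auto
  next
    case (Suc i)
    then obtain j' where j': "j = Suc j'" by (cases j) auto
    have "?g i \<in> S - {e}" "?g j' \<in> S - {e}"
      using Suc.prems inS[of i] inS[of j'] j' by auto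
    moreover have "?g i \<noteq> ?g j'" using Suc j' by auto
    ultimately show ?case using assms(4) j' by (auto simp: inj_on_def)
  qed
  have "\<exists>n. ?g n = e"
  proof (rule ccontr)
    assume no: "\<nexists>n. ?g n = e"
    then have "inj ?g" by (intro linorder_injI neq) auto
    moreover have "range ?g \<subseteq> S" using no inS by blast
    ultimately show False using assms(1) by (meson finite_subset infinite_UNIV_nat range_inj_infinite)
  qed
  define n where "n = (LEAST n. ?g n = e)"
  have n: "?g n = e" "\<And>i. i < n \<Longrightarrow> ?g i \<noteq> e"
    using LeastI_ex[OF \<open>\<exists>n. ?g n = e\<close>] not_less_Least unfolding n_def by blast+
  show ?thesis
  proof (rule that[of n])
    show "inj_on ?g {..n}" by (rule linorder_inj_onI) (use neq n(2) in auto)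
    show "?g i \<in> S" if "i \<le> n" for i using that inS n(2) by auto
  qed (use n in auto)
qed

text \<open>To treat growth to the right and to the left uniformly, columns are measured by
  \<open>\<epsilon> * fst p\<close> with \<open>\<epsilon> = 1\<close> or \<open>\<epsilon> = -1\<close>. The cut \<open>c\<close> separates the columns of height
  less than \<open>c\<close> from the others.\<close>

locale path_system = directed_system +
  fixes \<epsilon> :: int and n :: nat and p :: "nat \<Rightarrow> pos"
  assumes \<epsilon>: "\<epsilon> = 1 \<or> \<epsilon> = -1" and path: "simple_path n p"
begin

definition height :: "pos \<Rightarrow> int" where
  "height q = \<epsilon> * fst q"

section \<open>Crossings of a cut by the path\<close>

definition outward :: "int \<Rightarrow> nat set" where
  "outward c = {i. i < n \<and> height (p i) < c \<and> c \<le> height (p (Suc i))}"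

definition inward :: "int \<Rightarrow> nat set" where
  "inward c = {i. i < n \<and> c \<le> height (p i) \<and> height (p (Suc i)) < c}"

definition exits :: "int \<Rightarrow> (int \<times> int) set" where
  "exits c = (\<lambda>i. snd (p (Suc i))) ` outward c"

definition entries :: "int \<Rightarrow> (int \<times> int) set" where
  "entries c = (\<lambda>i. snd (p (Suc i))) ` inward c"

text \<open>The first coordinate at height \<open>c\<close> is \<open>\<epsilon> * c\<close> because
  \<open>\<epsilon>\<close> is its own inverse. Restricting to the exits makes equal records equal
  functions and lets them be counted by \<open>PiE\<close>.\<close>

definition exit_tiles :: "int \<Rightarrow> int \<times> int \<Rightarrow> tile" where
  "exit_tiles c = restrict (\<lambda>yz. the (\<alpha> (\<epsilon> * c, yz))) (exits c)"

lemma p_0: "p 0 = seed"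
  and p_inj: "inj_on p {..n}"
  and p_bonded: "i < n \<Longrightarrow> bonded \<alpha> (p i) (p (Suc i))"
  using path by (auto simp: simple_path_def)

lemma p_eq_iff: "i \<le> n \<Longrightarrow> j \<le> n \<Longrightarrow> p i = p j \<longleftrightarrow> i = j"
  using p_inj by (auto simp: inj_on_def)

lemma p_tile: "i \<le> n \<Longrightarrow> \<exists>t. \<alpha> (p i) = Some t"
  using p_bonded[of "i - 1"] seed_tile p_0 by (cases i) (auto simp: bonded_def)

lemma height_shift: "height (shift (\<epsilon> * w) q) = height q + w"
  using \<epsilon> by (auto simp: height_def algebra_simps)

lemma pos_eqI: "height q = height r \<Longrightarrow> snd q = snd r \<Longrightarrow> q = r"
  using \<epsilon> by (auto simp: height_def prod_eq_iff)

lemma height_step: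
  assumes "i < n"
  shows "\<bar>height (p (Suc i)) - height (p i)\<bar> \<le> 1"
    and "height (p (Suc i)) \<noteq> height (p i) \<Longrightarrow> snd (p (Suc i)) = snd (p i)"
proof -
  obtain d where "p (Suc i) = neighbor (p i) d"
    using p_bonded[OF assms] unfolding bonded_def by blast
  with neighbor_coordinates[of "p i" d] \<epsilon>
  show "\<bar>height (p (Suc i)) - height (p i)\<bar> \<le> 1"
    and "height (p (Suc i)) \<noteq> height (p i) \<Longrightarrow> snd (p (Suc i)) = snd (p i)"
    by (auto simp: height_def)
qed

lemma outwardD:
  assumes "i \<in> outward c"
  shows "i < n" "height (p i) = c - 1" "height (p (Suc i)) = c" "snd (p (Suc i)) = snd (p i)"
  using height_step[of i] assms by (auto simp: outward_def)

lemma inwardD: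
  assumes "i \<in> inward c"
  shows "i < n" "height (p i) = c" "height (p (Suc i)) = c - 1" "snd (p (Suc i)) = snd (p i)"
  using height_step[of i] assms by (auto simp: inward_def)

lemma exit_tiles_eq:
  assumes "i \<in> outward c"
  shows "\<alpha> (p (Suc i)) = Some (exit_tiles c (snd (p (Suc i))))"
proof -
  have "\<epsilon> * height (p (Suc i)) = fst (p (Suc i))"
    using \<epsilon> by (auto simp: height_def)
  then have "p (Suc i) = (\<epsilon> * c, snd (p (Suc i)))"
    using outwardD(3)[OF assms] by (auto simp: prod_eq_iff)
  moreover have "snd (p (Suc i)) \<in> exits c"
    using assms by (auto simp: exits_def)
  ultimately show ?thesis
    using p_tile[of "Suc i"] outwardD(1)[OF assms] by (auto simp: exit_tiles_def)
qed

text \<open>Crossing at one place in both directions would visit the same two positions in opposite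
  orders, which a simple path cannot do.\<close>

lemma exits_entries_disjoint: "exits c \<inter> entries c = {}"
proof (rule ccontr)
  assume "exits c \<inter> entries c \<noteq> {}"
  then obtain yz where "yz \<in> exits c" "yz \<in> entries c" by blast
  then obtain i j where ij: "i \<in> outward c" "j \<in> inward c" "snd (p (Suc i)) = snd (p (Suc j))"
    unfolding exits_def entries_def by (metis (no_types, lifting) imageE)
  note o = outwardD[OF ij(1)] and w = inwardD[OF ij(2)]
  have "p i = p (Suc j)" "p (Suc i) = p j"
    by (rule pos_eqI; use o w ij(3) in simp)+
  then have "i = Suc j" "Suc i = j"
    using o(1) w(1) p_eq_iff by auto
  then show False by simp
qed

text \<open>Crossings of a cut alternate, so a path that starts inside leaves at most once more often than
  it returns. Only the outward half of the crossings contributes a factor \<open>card T\<close> to the number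
  of crossing patterns.\<close>

lemma card_outward_le:
  assumes "height seed < c"
  shows "card (outward c) \<le> Suc (card (inward c))"
proof -
  define O' where "O' m = {i. i < m \<and> height (p i) < c \<and> c \<le> height (p (Suc i))}" for m
  define I' where "I' m = {i. i < m \<and> c \<le> height (p i) \<and> height (p (Suc i)) < c}" for m
  \<comment> \<open>For prefixes of the path the count is exact: the surplus is 1 while the path is
    outside and 0 while it is inside.\<close>
  have "card (O' m) = card (I' m) + (if c \<le> height (p m) then 1 else 0)" for m
  proof (induction m)
    case 0
    show ?case using assms p_0 by (simp add: O'_def I'_def)
  next
    case (Suc m)
    have fin: "finite (O' m)" "finite (I' m)" "m \<notin> O' m" "m \<notin> I' m"
      by (auto simp: O'_def I'_def)
    have "O' (Suc m) = (if height (p m) < c \<and> c \<le> height (p (Suc m)) then insert m (O' m) else O' m)"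
      "I' (Suc m) = (if c \<le> height (p m) \<and> height (p (Suc m)) < c then insert m (I' m) else I' m)"
      by (auto simp: O'_def I'_def less_Suc_eq)
    with Suc fin show ?case by auto
  qed
  from this[of n] show ?thesis
    by (simp add: outward_def inward_def O'_def I'_def split: if_splits)
qed

text \<open>Exits and entries are disjoint in \<open>L\<close>, and exits exceed entries by at most
  one. So twice the number of exits is at most \<open>2 * k + 1\<close>, and integrality gives
  \<open>k\<close>.\<close>

lemma card_exits_le:
  assumes "height seed < c" "finite L" "exits c \<subseteq> L" "entries c \<subseteq> L" "card L \<le> 2 * k"
  shows "card (exits c) \<le> k"
proof -
  have fin: "finite (outward c)" by (simp add: outward_def)
  have "inj_on (\<lambda>i. snd (p (Suc i))) (inward c)"
  proof (rule inj_onI)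
    fix i j assume ij: "i \<in> inward c" "j \<in> inward c" "snd (p (Suc i)) = snd (p (Suc j))"
    then have "p (Suc i) = p (Suc j)" using inwardD(3) by (intro pos_eqI) auto
    with inwardD(1) ij show "i = j" by (simp add: p_eq_iff Suc_leI)
  qed
  then have "card (entries c) = card (inward c)"
    unfolding entries_def by (rule card_image)
  moreover have "card (exits c) \<le> card (outward c)"
    unfolding exits_def using fin by (rule card_image_le)
  moreover have "card (exits c \<union> entries c) \<le> card L"
    using assms by (intro card_mono) auto
  moreover have "card (exits c \<union> entries c) = card (exits c) + card (entries c)"
    using assms exits_entries_disjoint by (intro card_Un_disjoint) (auto intro: finite_subset)
  ultimately show ?thesis using card_outward_le[OF assms(1)] assms(5) by linarith
qed

text \<open>The inner pieces of the path at the cut \<open>b\<close> and the shifted outer pieces at the cut \<open>a\<close>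
  fit together. A state \<open>(False, i)\<close> stands for the position \<open>p i\<close> inside the cut \<open>b\<close>, a state
  \<open>(True, i)\<close> for the shift of \<open>p i\<close> outside the cut \<open>a\<close>. The successor map is injective and does
  not hit the seed, so starting from there one runs through pairwise distinct positions until the
  shifted end of the path. The glues of inward crossings need not agree in advance: directedness
  forces the tile that attaches there.\<close>

lemma splice:
  assumes "height seed < a" "a < b" "b \<le> height (p n)"
    and "exits a = exits b" "entries a = entries b" "exit_tiles a = exit_tiles b"
  shows "\<alpha> (shift (\<epsilon> * (b - a)) (p n)) \<noteq> None"
proof -
  define sh where "sh = shift (\<epsilon> * (b - a))"
  have h_sh: "height (sh q) = height q + (b - a)" for q
    by (simp add: sh_def height_shift)
  have sh_inj: "sh q = sh r \<longleftrightarrow> q = r" and snd_sh: "snd (sh q) = snd q" for q r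
    by (simp_all add: sh_def)
  have "\<exists>j. j \<in> outward a \<and> sh (p (Suc j)) = p (Suc i) \<and> \<alpha> (p (Suc j)) = \<alpha> (p (Suc i))"
    if i: "i \<in> outward b" for i
  proof -
    from i assms(4) obtain j where j: "j \<in> outward a" "snd (p (Suc j)) = snd (p (Suc i))"
      unfolding exits_def by (metis (no_types, lifting) image_iff)
    have "sh (p (Suc j)) = p (Suc i)"
      by (rule pos_eqI) (use outwardD(3)[OF i] outwardD(3)[OF j(1)] j(2) in \<open>auto simp: h_sh snd_sh\<close>)
    with j assms(6) exit_tiles_eq[OF i] exit_tiles_eq[OF j(1)] show ?thesis by metis
  qed
  \<comment> \<open>The two matchings run in opposite directions: \<open>out\<close> sends exits at
    \<open>b\<close> to exits at \<open>a\<close>, while \<open>inn\<close> below sends entries at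
    \<open>a\<close> to entries at \<open>b\<close>.\<close>
  then obtain out where out: "\<And>i. i \<in> outward b \<Longrightarrow> out i \<in> outward a"
    "\<And>i. i \<in> outward b \<Longrightarrow> sh (p (Suc (out i))) = p (Suc i)"
    "\<And>i. i \<in> outward b \<Longrightarrow> \<alpha> (p (Suc (out i))) = \<alpha> (p (Suc i))"
    by metis
  have "\<exists>j. j \<in> inward b \<and> p (Suc j) = sh (p (Suc i))" if i: "i \<in> inward a" for i
  proof -
    from i assms(5) obtain j where j: "j \<in> inward b" "snd (p (Suc j)) = snd (p (Suc i))"
      unfolding entries_def by (metis (no_types, lifting) image_iff)
    have "p (Suc j) = sh (p (Suc i))"
      by (rule pos_eqI) (use inwardD(3)[OF i] inwardD(3)[OF j(1)] j(2) in \<open>auto simp: h_sh snd_sh\<close>)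
    with j show ?thesis by blast
  qed
  then obtain inn where inn: "\<And>i. i \<in> inward a \<Longrightarrow> inn i \<in> inward b"
    "\<And>i. i \<in> inward a \<Longrightarrow> p (Suc (inn i)) = sh (p (Suc i))"
    by metis
  define S where "S = {(o', i). i \<le> n \<and> (if o' then a \<le> height (p i) else height (p i) < b)}"
  \<comment> \<open>Follow the path, but on leaving through \<open>b\<close> continue in the shifted
    copy, and on re-entering through the shifted \<open>a\<close> continue in the original.\<close>
  define f where "f = (\<lambda>(o', i).
     if o' then (if i \<in> inward a then (False, Suc (inn i)) else (True, Suc i))
     else (if i \<in> outward b then (True, Suc (out i)) else (False, Suc i)))"
  define pos where "pos = (\<lambda>(o', i). if o' then sh (p i) else p i)"
  let ?e = "(True, n)"
  \<comment> \<open>The path ends at height at least \<open>b\<close>, so \<open>(False, n)\<close>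
    is no state and only \<open>?e\<close> lacks a next step.\<close>
  have lt_n: "i < n" if "(o', i) \<in> S - {?e}" for o' i
  proof -
    have "i \<noteq> n" using that assms(3) by (auto simp: S_def split: if_splits)
    with that show ?thesis by (auto simp: S_def)
  qed
  have finS: "finite S"
    by (rule finite_subset[of _ "UNIV \<times> {..n}"]) (auto simp: S_def)
  have startS: "(False, 0) \<in> S" using assms p_0 by (simp add: S_def)
  have f_S: "f ` (S - {?e}) \<subseteq> S"
  proof
    fix y assume "y \<in> f ` (S - {?e})"
    then obtain o' i where oi: "(o', i) \<in> S - {?e}" "y = f (o', i)" by auto
    from lt_n[OF oi(1)] have i: "i < n" .
    show "y \<in> S"
    proof (cases o')
      case True
      with oi(1) have "a \<le> height (p i)" by (auto simp: S_def)
      with i True oi(2) inwardD(1,3)[OF inn(1)[of i]] show ?thesis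
        by (cases "i \<in> inward a") (auto simp: S_def f_def inward_def)
    next
      case False
      with oi(1) have "height (p i) < b" by (auto simp: S_def)
      with i False oi(2) outwardD(1,3)[OF out(1)[of i]] show ?thesis
        by (cases "i \<in> outward b") (auto simp: S_def f_def outward_def)
    qed
  qed
  have f_inj: "inj_on f (S - {?e})"
  proof (rule inj_onI)
    fix x y assume xy: "x \<in> S - {?e}" "y \<in> S - {?e}" "f x = f y"
    obtain ox i oy j where x: "x = (ox, i)" and y: "y = (oy, j)" by fastforce
    have ij: "i < n" "j < n" using xy lt_n x y by auto
    have in_S: "\<not> o' \<Longrightarrow> height (p i) < b" "o' \<Longrightarrow> a \<le> height (p i)" if "(o', i) \<in> S - {?e}" for o' i
      using that by (auto simp: S_def)
    have out_inj: "i = j" if "i \<in> outward b" "j \<in> outward b" "out i = out j" for i j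
      using out(2)[OF that(1)] out(2)[OF that(2)] that outwardD(1) p_eq_iff
      by (metis Suc_inject Suc_leI)
    have inn_inj: "i = j" if "i \<in> inward a" "j \<in> inward a" "inn i = inn j" for i j
      using inn(2)[OF that(1)] inn(2)[OF that(2)] that inwardD(1) p_eq_iff sh_inj
      by (metis Suc_inject Suc_leI)
    \<comment> \<open>A switch and an ordinary step never lead to the same state: the matched
      crossing starts on the side of its cut that the states of the copy entered exclude.\<close>
    have cross: "out i \<noteq> j" if "i \<in> outward b" "a \<le> height (p j)" for i j
      using outwardD(2)[OF out(1)[OF that(1)]] that(2) by auto
    have cross': "inn i \<noteq> j" if "i \<in> inward a" "height (p j) < b" for i j
      using inwardD(2)[OF inn(1)[OF that(1)]] that(2) by auto
    show "x = y"
      using xy(3) in_S[OF xy(1)[unfolded x]] in_S[OF xy(2)[unfolded y]]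
        out_inj[of i j] inn_inj[of i j] cross[of i j] cross[of j i] cross'[of i j] cross'[of j i]
      unfolding x y f_def by (auto split: if_splits)
  qed
  have start: "(False, 0) \<notin> f ` (S - {?e})"
    by (auto simp: f_def split: if_splits)
  have pos_inj: "inj_on pos S"
  proof (rule inj_onI)
    fix x y assume xy: "x \<in> S" "y \<in> S" "pos x = pos y"
    \<comment> \<open>The shift lifts outer states to height at least \<open>b\<close>, so the two
      copies are disjoint in space, even though an index between the cuts occurs in both.\<close>
    have "sh (p i) \<noteq> p j" if "a \<le> height (p i)" "height (p j) < b" for i j
      using h_sh[of "p i"] that by auto
    with xy show "x = y"
      by (cases x; cases y) (auto simp: S_def pos_def sh_inj p_eq_iff split: if_splits, metis+)
  qed
  obtain m where m: "(f ^^ m) (False, 0) = ?e" "inj_on (\<lambda>i. (f ^^ i) (False, 0)) {..m}"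
    "\<And>i. i \<le> m \<Longrightarrow> (f ^^ i) (False, 0) \<in> S" "\<And>i. i < m \<Longrightarrow> (f ^^ i) (False, 0) \<noteq> ?e"
    using injective_orbit[OF finS startS f_S f_inj start] by metis
  define st where "st i = (f ^^ i) (False, 0)" for i
  \<comment> \<open>The second conjunct says that the spliced position carries the tile of the path
    position it copies, so the next bond of the path is available there.\<close>
  have inv: "grows (\<alpha> |` ((pos \<circ> st) ` {..l})) \<and> \<alpha> (pos (st l)) = \<alpha> (p (snd (st l)))"
    if "l \<le> m" for l
    using that
  proof (induction l)
    case 0
    have "\<alpha> |` {seed} = [seed \<mapsto> t0]" using seed_tile by (auto simp: restrict_map_def fun_eq_iff)
    then show ?case using p_0 by (simp add: st_def pos_def)
  next
    case (Suc l)
    define P where "P = (pos \<circ> st) ` {..l}"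
    obtain o' i where oi: "st l = (o', i)" by fastforce
    have stS: "st l \<in> S - {?e}" using m(3,4)[of l] Suc.prems by (auto simp: st_def)
    with lt_n oi have i: "i < n" by auto
    have "grows (\<alpha> |` P) \<and> \<alpha> (pos (st l)) = \<alpha> (p (snd (st l)))"
      using Suc.IH Suc.prems unfolding P_def by (meson Suc_leD)
    then have IH: "grows (\<alpha> |` P)" "\<alpha> (pos (st l)) = \<alpha> (p i)"
      by (simp_all only: oi snd_conv)
    have nxt: "st (Suc l) = f (o', i)" using oi by (simp add: st_def)
    have P_Suc: "(pos \<circ> st) ` {..Suc l} = insert (pos (st (Suc l))) P"
      by (simp add: P_def atMost_Suc)
    have fresh: "pos (st (Suc l)) \<notin> P"
    proof
      assume "pos (st (Suc l)) \<in> P"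
      then obtain l' where l': "l' \<le> l" "pos (st (Suc l)) = pos (st l')" by (auto simp: P_def)
      moreover have "st (Suc l) \<in> S" "st l' \<in> S"
        using m(3)[of "Suc l"] m(3)[of l'] l'(1) Suc.prems by (simp_all add: st_def)
      ultimately have "st (Suc l) = st l'"
        using pos_inj by (simp add: inj_on_def)
      then have "Suc l = l'"
        using m(2) l'(1) Suc.prems unfolding inj_on_def st_def by (meson atMost_iff le_SucI le_trans)
      with l'(1) show False by simp
    qed
    obtain d t s where b: "p (Suc i) = neighbor (p i) d" "\<alpha> (p i) = Some t" "\<alpha> (p (Suc i)) = Some s"
      "t d = s (opposite d)" "snd (t d) > 0"
      using p_bonded[OF i] unfolding bonded_def by blast
    have pos_next: "pos (st (Suc l)) = neighbor (pos (st l)) d"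
    proof (cases o')
      case True
      have "neighbor (sh (p i)) d = sh (p (Suc i))"
        using b(1) by (simp add: sh_def neighbor_shift)
      then show ?thesis using True inn(2)[of i] oi by (auto simp: nxt pos_def f_def)
    next
      case False
      then show ?thesis using b(1) out(2)[of i] oi by (auto simp: nxt pos_def f_def)
    qed
    have "s \<in> T" using b(3) by (rule terminal_structure(1))
    then have new: "\<alpha> (neighbor (pos (st l)) d) = Some s"
      and g: "grows (\<alpha> |` insert (neighbor (pos (st l)) d) P)"
      using growth_forced[OF IH(1), of "pos (st l)" t d s] IH(2) b fresh pos_next
      by (auto simp: P_def)
    \<comment> \<open>Exits match in their tiles, which gives the first alternative. After switching
      back inside, the spliced position is itself a path position, and \<open>growth_forced\<close>
      has determined its tile.\<close>
    have "\<alpha> (p (snd (st (Suc l)))) = Some s \<or> p (snd (st (Suc l))) = pos (st (Suc l))"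
      using b(3) out(3)[of i] by (auto simp: nxt f_def pos_def)
    then have "\<alpha> (pos (st (Suc l))) = \<alpha> (p (snd (st (Suc l))))"
      using new pos_next by metis
    moreover have "grows (\<alpha> |` ((pos \<circ> st) ` {..Suc l}))"
      using g by (simp only: P_Suc pos_next)
    ultimately show ?case by blast
  qed
  from inv[of m] m(1) have "\<alpha> (sh (p n)) = \<alpha> (p n)"
    by (simp add: st_def pos_def)
  with p_tile[of n] show ?thesis by (simp add: sh_def)
qed

section \<open>Counting crossing patterns\<close>

text \<open>Two cuts with one pattern would yield a tile beyond the maximal height
  \<open>height (p n)\<close>. The base 16 comes from at most \<open>4 ^ k\<close> sets of exits and
  \<open>4 ^ k\<close> sets of entries.\<close>

lemma card_cuts_le:
  assumes "dom \<alpha> \<subseteq> UNIV \<times> L" "finite L" "card L \<le> 2 * k"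
    and max: "\<And>q. q \<in> dom \<alpha> \<Longrightarrow> height q \<le> height (p n)"
  shows "height (p n) - height seed \<le> int ((16 * card T) ^ k)"
proof -
  define C where "C = {height seed<..height (p n)}"
  define W where "W = (SIGMA X : {X. X \<subseteq> L \<and> card X \<le> k}. PiE X (\<lambda>_. T))"
  define pat where "pat c = ((exits c, exit_tiles c), entries c)" for c
  have sub: "snd (p i) \<in> L" if "i \<le> n" for i
    using p_tile[OF that] assms(1) by (metis SigmaD2 domI prod.collapse subsetD)
  have pat: "pat c \<in> W \<times> Pow L" if "c \<in> C" for c
  proof -
    have *: "exits c \<subseteq> L" "entries c \<subseteq> L"
      using sub by (auto simp: exits_def entries_def outward_def inward_def)
    have "exit_tiles c \<in> exits c \<rightarrow>\<^sub>E T"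
    proof (rule PiE_I)
      fix yz assume "yz \<in> exits c"
      then obtain i where "i \<in> outward c" "yz = snd (p (Suc i))" by (auto simp: exits_def)
      then show "exit_tiles c yz \<in> T" using exit_tiles_eq terminal_structure(1) by metis
    qed (simp add: exit_tiles_def)
    moreover have "card (exits c) \<le> k"
      using card_exits_le[OF _ assms(2) * assms(3)] that by (simp add: C_def)
    ultimately show ?thesis using * by (simp add: pat_def W_def)
  qed
  have pow: "card (Pow L) \<le> 4 ^ k"
  proof -
    have "(2::nat) ^ card L \<le> 2 ^ (2 * k)" using assms(3) by (intro power_increasing) auto
    then show ?thesis using assms(2) by (simp add: card_Pow power_mult)
  qed
  \<comment> \<open>Nonemptiness of \<open>T\<close> lets exit sets with fewer than \<open>k\<close>
    elements be bounded by \<open>card T ^ k\<close> as well.\<close>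
  have T_pos: "1 \<le> card T" using finite_T t0 by (metis One_nat_def Suc_leI card_gt_0_iff empty_iff)
  have finX: "finite {X. X \<subseteq> L \<and> card X \<le> k}" using assms(2) by simp
  have "card W = (\<Sum>X | X \<subseteq> L \<and> card X \<le> k. card (X \<rightarrow>\<^sub>E T))"
    unfolding W_def using finX finite_T assms(2)
    by (intro card_SigmaI) (auto intro!: finite_PiE intro: finite_subset)
  also have "\<dots> \<le> (\<Sum>X | X \<subseteq> L \<and> card X \<le> k. card T ^ k)"
  proof (rule sum_mono)
    fix X assume "X \<in> {X. X \<subseteq> L \<and> card X \<le> k}"
    then have "finite X" "card X \<le> k" using assms(2) finite_subset by auto
    then show "card (X \<rightarrow>\<^sub>E T) \<le> card T ^ k"
      using T_pos by (simp add: card_PiE power_increasing)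
  qed
  also have "\<dots> \<le> 4 ^ k * card T ^ k"
  proof -
    have "card {X. X \<subseteq> L \<and> card X \<le> k} \<le> card (Pow L)"
      using assms(2) by (intro card_mono) auto
    with pow show ?thesis by simp
  qed
  finally have W: "card W \<le> 4 ^ k * card T ^ k" .
  have "card (W \<times> Pow L) \<le> (4 ^ k * card T ^ k) * 4 ^ k"
    unfolding card_cartesian_product using W pow by (rule mult_le_mono)
  also have "\<dots> = (4 * card T * 4) ^ k"
    by (simp only: power_mult_distrib)
  also have "4 * card T * 4 = 16 * card T" by simp
  finally have card_le: "card (W \<times> Pow L) \<le> (16 * card T) ^ k" .
  have finW: "finite (W \<times> Pow L)"
    unfolding W_def using finX finite_T assms(2)
    by (intro finite_cartesian_product finite_SigmaI) (auto intro!: finite_PiE intro: finite_subset)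
  have "inj_on pat C"
  proof (rule linorder_inj_onI)
    fix a b assume ab: "a < b" "a \<in> C" "b \<in> C"
    show "pat a \<noteq> pat b"
    proof
      assume "pat a = pat b"
      with splice[of a b] ab have "shift (\<epsilon> * (b - a)) (p n) \<in> dom \<alpha>"
        by (auto simp: pat_def C_def)
      from max[OF this] ab(1) show False by (simp add: height_shift)
    qed
  qed auto
  then have "card C \<le> card (W \<times> Pow L)"
    using pat finW by (intro card_inj_on_le[of pat] image_subsetI)
  with card_le have "card C \<le> (16 * card T) ^ k" by linarith
  then show ?thesis unfolding C_def card_greaterThanAtMost_int nat_le_iff .
qed

end

section \<open>From cuts to the length of the rectangle\<close>

text \<open>The seed may lie in any column, so the cut bound is applied towards both ends and the
  two distances are added.\<close>

lemma (in directed_system) rectangle_length_le: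
  assumes R: "rectangle3 k N (dom \<alpha>)" and "k > 0" "N > 0"
  shows "N \<le> (48 * card T) ^ k"
proof -
  define L where "L = {0..<int k} \<times> {0..1::int}"
  have L: "dom \<alpha> \<subseteq> UNIV \<times> L" "finite L" "card L \<le> 2 * k"
    using R by (auto simp: rectangle3_def L_def)
  have dom_x: "0 \<le> fst q" "fst q < int N" if "q \<in> dom \<alpha>" for q
    using R that by (auto simp: rectangle3_def)
  have mem: "(x, 0, 0) \<in> dom \<alpha>" if "0 \<le> x" "x < int N" for x
  proof -
    have "(x, 0, 0) \<in> {0..<int N} \<times> {0..<int k} \<times> {0}" using that \<open>k > 0\<close> by simp
    with R show ?thesis unfolding rectangle3_def by blast
  qed
  have bound: "\<epsilon> * x - \<epsilon> * fst seed \<le> int ((16 * card T) ^ k)"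
    if \<epsilon>: "\<epsilon> = 1 \<or> \<epsilon> = -1" and x: "0 \<le> x" "x < int N"
      and max: "\<And>q. q \<in> dom \<alpha> \<Longrightarrow> \<epsilon> * fst q \<le> \<epsilon> * x" for \<epsilon> x
  proof -
    from mem[OF x] terminal_structure(2) obtain n p where np: "simple_path n p" "p n = (x, 0, 0)"
      by blast
    interpret path_system T seed t0 \<alpha> \<epsilon> n p
      using \<epsilon> np(1) by unfold_locales
    show ?thesis
      using card_cuts_le[OF L] max np(2) by (simp add: height_def)
  qed
  have right: "int N - 1 - fst seed \<le> int ((16 * card T) ^ k)"
    using bound[of 1 "int N - 1"] dom_x \<open>N > 0\<close> by force
  have left: "fst seed \<le> int ((16 * card T) ^ k)"
    using bound[of "-1" 0] dom_x \<open>N > 0\<close> by force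
  from left right have "int N \<le> int (2 * (16 * card T) ^ k + 1)" by simp
  then have "N \<le> 2 * (16 * card T) ^ k + 1" by linarith
  also have "\<dots> \<le> 3 * (16 * card T) ^ k"
  proof -
    have "card T > 0" using finite_T t0 card_gt_0_iff by blast
    then have "1 \<le> (16 * card T) ^ k" by (intro one_le_power) simp
    then show ?thesis by simp
  qed
  \<comment> \<open>Moving the factor 3 under the power keeps the final constant independent of
    \<open>k\<close>.\<close>
  also have "\<dots> \<le> 3 ^ k * (16 * card T) ^ k"
    using \<open>k > 0\<close> self_le_power[of "3::nat" k] by (intro mult_right_mono) auto
  also have "\<dots> = (3 * (16 * card T)) ^ k"
    by (rule power_mult_distrib[symmetric])
  also have "3 * (16 * card T) = 48 * card T" by simp
  finally show ?thesis .
qed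

theorem theorem1:
  shows "\<exists>c::real. c > 0 \<and>
    (\<forall>(k::nat) (N::nat) R. k > 0 \<longrightarrow> N > 0 \<longrightarrow> rectangle3 k N R \<longrightarrow>
      ereal_of_enat (K_USA 1 R) \<ge> ereal (c * real N powr (1 / real k)))"
proof (intro exI[of _ "1 / 48 :: real"] conjI allI impI)
  fix k N :: nat and R
  assume k: "k > 0" and N: "N > 0" and R: "rectangle3 k N R"
  define K where "K = {enat (card T) | T. \<exists>\<sigma>. tas T \<sigma> 1 \<and> uniquely_self_assembles R T \<sigma> 1}"
  show "ereal (1 / 48 * real N powr (1 / real k)) \<le> ereal_of_enat (K_USA 1 R)"
  proof (cases "K = {}")
    \<comment> \<open>No system assembles \<open>R\<close>, so the infimum is infinite.\<close>
    case True
    then show ?thesis unfolding K_USA_def K_def[symmetric] by (simp add: top_enat_def)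
  next
    case False
    \<comment> \<open>A nonempty set in \<open>enat\<close> attains its infimum, which yields an
      optimal system.\<close>
    then have "Inf K \<in> K" unfolding Inf_enat_def by (auto intro: LeastI)
    then obtain T \<sigma> where T: "Inf K = enat (card T)" "tas T \<sigma> 1" "uniquely_self_assembles R T \<sigma> 1"
      unfolding K_def by blast
    then obtain q t \<alpha> where \<sigma>: "\<sigma> = [q \<mapsto> t]" "t \<in> T" "finite T"
      and \<alpha>: "directed T \<sigma> 1" "terminal T \<sigma> 1 \<alpha>" "dom \<alpha> = R"
      unfolding tas_def uniquely_self_assembles_def by blast
    interpret directed_system T q t \<alpha>
      using \<sigma> \<alpha> by unfold_locales auto
    \<comment> \<open>Taking the \<open>k\<close>-th root of this bound produces the constant
      \<open>1 / 48\<close>.\<close>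
    have "real N \<le> (48 * real (card T)) ^ k"
      using rectangle_length_le[of k N] \<alpha>(3) R k N
      by (metis of_nat_le_iff of_nat_mult of_nat_numeral of_nat_power)
    then have "real N powr (1 / real k) \<le> ((48 * real (card T)) ^ k) powr (1 / real k)"
      by (intro powr_mono2) auto
    also have "\<dots> = 48 * real (card T)"
    proof -
      have "(x ^ k) powr (1 / real k) = x" if "x \<ge> 0" for x :: real
        using that k by (cases "x = 0") (simp_all add: powr_realpow[symmetric] powr_powr)
      from this[of "48 * real (card T)"] show ?thesis by linarith
    qed
    finally show ?thesis
      unfolding K_USA_def K_def[symmetric] T(1) by simp
  qed
qed simp

end
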